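(* Let $\boldsymbol\delta=(\delta_0,\delta_1,\dots)$ be nonnegative weights with $\Delta(x)=\sum_{d\ge0}\delta_d x^d/d!$, and let $\mathcal F$ be a multigraph family with degree-marked generating function $F(z,w,\mathbf y)$. Let $\operatorname{MG}^{[\mathcal F]}_{n,m,\Delta}=\sum \omega_\Delta(G)$, the sum being over all pairs $(G,H)$ with $G$ an $(n,m)$-multigraph and $H$ an $\mathcal F$-subgraph of $G$. Then \[ \operatorname{MG}^{[\mathcal F]}_{n,m,\Delta}= n!\,2^m\,m!\,[z^nw^m]\sum_{j\ge0}(2j)!\,[x^{2j}]\,F\big(z,w,\bar\partial\Delta(x)\big)\,e^{z\Delta(x)}\,\frac{w^j}{2^j j!}, \] where $\bar\partial\Delta(x)=(\Delta(x),\Delta'(x),\Delta''(x),\dots)$, i.e. $y_d$ is replaced by $\Delta^{(d)}(x)$ for every $d\ge0$.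
   Context: A multigraph has vertices labeled by distinct integers and edges given as triples $(v,w,e)$ (oriented from $v$ to $w$, loops and multiple edges allowed, $e$ a distinct integer edge label). An $(n,m)$-multigraph has vertex labels $1,\dots,n$ and edge labels $1,\dots,m$. The degree $\deg(v)$ of a vertex is the number of edge endpoints at $v$ (a loop counts twice). The weight of a multigraph $G$ is $\omega_\Delta(G)=\prod_{v\in V(G)}\delta_{\deg(v)}$. A multigraph family $\mathcal F$ is a set of canonically labeled multigraphs closed under isomorphism (isomorphism ignores labels); an $\mathcal F$-subgraph of $G$ is a subgraph of $G$ isomorphic to a member of $\mathcal F$. Its degree-marked generating function is $F(z,w,\mathbf y)=\sum_{H\in\mathcal F}\big(\prod_{v\in V(H)} y_{\deg_H(v)}\big)\frac{w^{m(H)}}{2^{m(H)}m(H)!}\frac{z^{n(H)}}{n(H)!}$, with $\mathbf y=(y_0,y_1,\dots)$ formal variables and $\deg_H$ the degree in $H$. *)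

theory Defs
  imports
    "HOL-Computational_Algebra.Formal_Power_Series"
    "HOL-Library.Poly_Mapping"
begin

section \<open>Multigraphs\<close>

text \<open>
  Vertices and edges are identified with their labels; \<open>(v, w, e)\<close> is the edge with
  label \<open>e\<close>, oriented from \<open>v\<close> to \<open>w\<close>.
\<close>

datatype multigraph = Multigraph (verts: "int set") (edges: "(int \<times> int \<times> int) set")

definition edge_src :: "int \<times> int \<times> int \<Rightarrow> int"
  where "edge_src a = fst a"

definition edge_tgt :: "int \<times> int \<times> int \<Rightarrow> int"
  where "edge_tgt a = fst (snd a)"

definition edge_label :: "int \<times> int \<times> int \<Rightarrow> int"
  where "edge_label a = snd (snd a)"

definition wf_multigraph :: "multigraph \<Rightarrow> bool"
  where "wf_multigraph G \<longleftrightarrow>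
    finite (verts G) \<and> finite (edges G) \<and>
    (\<forall>a\<in>edges G. edge_src a \<in> verts G \<and> edge_tgt a \<in> verts G) \<and>
    inj_on edge_label (edges G)"

definition nm_multigraph :: "nat \<Rightarrow> nat \<Rightarrow> multigraph \<Rightarrow> bool"
  where "nm_multigraph n m G \<longleftrightarrow>
    wf_multigraph G \<and> verts G = {1..int n} \<and> edge_label ` edges G = {1..int m}"

definition deg :: "multigraph \<Rightarrow> int \<Rightarrow> nat"
  where "deg G v = card {a\<in>edges G. edge_src a = v} + card {a\<in>edges G. edge_tgt a = v}"

definition weight :: "(nat \<Rightarrow> real) \<Rightarrow> multigraph \<Rightarrow> real"
  where "weight \<delta> G = (\<Prod>v\<in>verts G. \<delta> (deg G v))"

text \<open>
  An isomorphism is a relabelling of vertices and edges; orientations are kept. Families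
  that are in addition closed under reversing edges are thus special cases of
  \<open>multigraph_family\<close>, and for them \<open>F_subgraph\<close> does not depend on whether
  isomorphisms are required to keep orientations.
\<close>

definition isomorphic :: "multigraph \<Rightarrow> multigraph \<Rightarrow> bool"
  where "isomorphic G H \<longleftrightarrow>
    (\<exists>\<phi> \<psi>. bij_betw \<phi> (verts G) (verts H) \<and>
           bij_betw \<psi> (edge_label ` edges G) (edge_label ` edges H) \<and>
           edges H = (\<lambda>(v, w, e). (\<phi> v, \<phi> w, \<psi> e)) ` edges G)"

definition subgraph :: "multigraph \<Rightarrow> multigraph \<Rightarrow> bool"
  where "subgraph H G \<longleftrightarrow> wf_multigraph H \<and> verts H \<subseteq> verts G \<and> edges H \<subseteq> edges G"

definition multigraph_family :: "multigraph set \<Rightarrow> bool"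
  where "multigraph_family F \<longleftrightarrow>
    (\<forall>H\<in>F. \<exists>n m. nm_multigraph n m H) \<and>
    (\<forall>H\<in>F. \<forall>H' n m. nm_multigraph n m H' \<and> isomorphic H H' \<longrightarrow> H' \<in> F)"

definition F_subgraph :: "multigraph set \<Rightarrow> multigraph \<Rightarrow> multigraph \<Rightarrow> bool"
  where "F_subgraph F H G \<longleftrightarrow> subgraph H G \<and> (\<exists>K\<in>F. isomorphic H K)"

definition MG_marked :: "multigraph set \<Rightarrow> nat \<Rightarrow> nat \<Rightarrow> (nat \<Rightarrow> real) \<Rightarrow> real"
  where "MG_marked F n m \<delta> =
    (\<Sum>(G, H)\<in>{(G, H). nm_multigraph n m G \<and> F_subgraph F H G}. weight \<delta> G)"

section \<open>Generating functions\<close>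

text \<open>
  Polynomials in the variables \<open>y\<^sub>0, y\<^sub>1, \<dots>\<close>: finitely supported functions from
  monomials to coefficients, a monomial being the finitely supported function of its exponents.
\<close>

type_synonym ypoly = "(nat \<Rightarrow>\<^sub>0 nat) \<Rightarrow>\<^sub>0 real"

definition y_const :: "real \<Rightarrow> ypoly"
  where "y_const c = Poly_Mapping.single 0 c"

definition y_var :: "nat \<Rightarrow> ypoly"
  where "y_var d = Poly_Mapping.single (Poly_Mapping.single d 1) 1"

definition y_subst :: "(nat \<Rightarrow> real fps) \<Rightarrow> ypoly \<Rightarrow> real fps"
  where "y_subst g p =
    (\<Sum>t\<in>Poly_Mapping.keys p. fps_const (Poly_Mapping.lookup p t) *
       (\<Prod>d\<in>Poly_Mapping.keys t. g d ^ Poly_Mapping.lookup t d))"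

text \<open>
  In nested power series, \<open>w\<close> is the outer variable, then \<open>z\<close>, then (where present) \<open>x\<close>.
  With \<open>w\<close> outermost, the library's topology on power series is the \<open>w\<close>-adic one, in which
  the sum over \<open>j\<close> in the theorem converges (\<open>summable_fps_X_power\<close> below).
\<close>

definition coeff_zw :: "nat \<Rightarrow> nat \<Rightarrow> 'a::zero fps fps \<Rightarrow> 'a"
  where "coeff_zw n m A = fps_nth (fps_nth A m) n"

definition map_coeffs :: "('a::zero \<Rightarrow> 'b::zero) \<Rightarrow> 'a fps fps \<Rightarrow> 'b fps fps"
  where "map_coeffs h A = Abs_fps (\<lambda>m. Abs_fps (\<lambda>n. h (coeff_zw n m A)))"

definition coeff_x :: "nat \<Rightarrow> real fps fps fps \<Rightarrow> real fps fps"
  where "coeff_x k = map_coeffs (\<lambda>f. fps_nth f k)"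

definition family_gf :: "multigraph set \<Rightarrow> ypoly fps fps"
  where "family_gf F = Abs_fps (\<lambda>m. Abs_fps (\<lambda>n.
    \<Sum>H\<in>{H\<in>F. card (verts H) = n \<and> card (edges H) = m}.
      (\<Prod>v\<in>verts H. y_var (deg H v)) * y_const (1 / (2 ^ m * fact m) * (1 / fact n))))"

definition Delta :: "(nat \<Rightarrow> real) \<Rightarrow> real fps"
  where "Delta \<delta> = Abs_fps (\<lambda>d. \<delta> d / fact d)"

text \<open>
  \<open>e^(z f(x)) = \<Sum>k. f(x)^k / k! z^k\<close>; \<open>fps_exp\<close> and \<open>fps_compose\<close> do not apply, since
  the coefficients are themselves power series in \<open>x\<close>.
\<close>

definition exp_z :: "real fps \<Rightarrow> real fps fps fps"
  where "exp_z f = fps_const (Abs_fps (\<lambda>k. fps_const (1 / fact k) * f ^ k))"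

definition real_const :: "real \<Rightarrow> real fps fps"
  where "real_const c = fps_const (fps_const c)"

section \<open>Well-definedness\<close>

lemma finite_nm_multigraphs: "finite {G. nm_multigraph n m G}"
proof -
  have "{G. nm_multigraph n m G} \<subseteq>
      Multigraph {1..int n} ` Pow ({1..int n} \<times> {1..int n} \<times> {1..int m})"
  proof
    fix G assume "G \<in> {G. nm_multigraph n m G}"
    then have G: "wf_multigraph G" "verts G = {1..int n}" "edge_label ` edges G = {1..int m}"
      by (auto simp: nm_multigraph_def)
    have "a \<in> {1..int n} \<times> {1..int n} \<times> {1..int m}" if "a \<in> edges G" for a
    proof -
      have "edge_src a \<in> {1..int n}" "edge_tgt a \<in> {1..int n}" "edge_label a \<in> {1..int m}"
        using G that by (auto simp: wf_multigraph_def)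
      then show ?thesis
        by (cases a) (simp add: edge_src_def edge_tgt_def edge_label_def)
    qed
    then have "edges G \<in> Pow ({1..int n} \<times> {1..int n} \<times> {1..int m})"
      by blast
    moreover have "G = Multigraph {1..int n} (edges G)"
      using G(2) by (cases G) simp
    ultimately show "G \<in> Multigraph {1..int n} ` Pow ({1..int n} \<times> {1..int n} \<times> {1..int m})"
      by blast
  qed
  then show ?thesis
    by (rule finite_subset) simp
qed

lemma finite_MG_marked_index: "finite {(G, H). nm_multigraph n m G \<and> F_subgraph F H G}"
proof -
  let ?S = "SIGMA G:{G. nm_multigraph n m G}.
    (\<lambda>(V, E). Multigraph V E) ` (Pow (verts G) \<times> Pow (edges G))"
  have "finite ?S"
    by (rule finite_SigmaI[OF finite_nm_multigraphs])
      (auto simp: nm_multigraph_def wf_multigraph_def)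
  moreover have "{(G, H). nm_multigraph n m G \<and> F_subgraph F H G} \<subseteq> ?S"
  proof (clarsimp simp: F_subgraph_def subgraph_def)
    fix G H assume "verts H \<subseteq> verts G" "edges H \<subseteq> edges G"
    then show "H \<in> (\<lambda>(V, E). Multigraph V E) ` (Pow (verts G) \<times> Pow (edges G))"
      by (intro image_eqI[of _ _ "(verts H, edges H)"]) auto
  qed
  ultimately show ?thesis
    by (rule rev_finite_subset)
qed

lemma finite_family_gf_index:
  assumes "multigraph_family F"
  shows "finite {H\<in>F. card (verts H) = n \<and> card (edges H) = m}"
proof (rule finite_subset[OF _ finite_nm_multigraphs[of n m]], safe)
  fix H assume "H \<in> F"
  then obtain n' m' where H: "nm_multigraph n' m' H"
    using assms by (auto simp: multigraph_family_def)
  then have "card (verts H) = n'"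
    by (simp add: nm_multigraph_def)
  moreover have "card (edges H) = m'"
    using H card_image[of edge_label "edges H"]
    by (simp add: nm_multigraph_def wf_multigraph_def)
  ultimately show "nm_multigraph (card (verts H)) (card (edges H)) H"
    using H by simp
qed

lemma summable_fps_X_power:
  fixes B :: "nat \<Rightarrow> 'a::comm_ring_1 fps"
  shows "summable (\<lambda>j. B j * fps_X ^ j)"
proof -
  let ?S = "Abs_fps (\<lambda>k. \<Sum>j\<le>k. fps_nth (B j * fps_X ^ j) k)"
  have "(\<lambda>N. \<Sum>j<N. B j * fps_X ^ j) \<longlonglongrightarrow> ?S"
  proof (rule tendsto_fpsI)
    fix k
    show "\<forall>\<^sub>F N in sequentially. fps_nth (\<Sum>j<N. B j * fps_X ^ j) k = fps_nth ?S k"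
      using eventually_gt_at_top[of k]
    proof eventually_elim
      case (elim N)
      have "fps_nth (\<Sum>j<N. B j * fps_X ^ j) k = (\<Sum>j<N. fps_nth (B j * fps_X ^ j) k)"
        by (simp add: fps_sum_nth)
      also have "\<dots> = (\<Sum>j\<le>k. fps_nth (B j * fps_X ^ j) k)"
        using elim by (intro sum.mono_neutral_right) (auto simp: fps_X_power_mult_right_nth)
      finally show ?case
        by simp
    qed
  qed
  then show ?thesis
    unfolding summable_def sums_def by blast
qed

end

theory Submission
  imports Defs "HOL-Library.FuncSet"
begin

text \<open>
  Sum over \<open>H\<close> first. The subgraphs isomorphic to a member of \<open>F\<close> with a given vertex set of size
  \<open>k\<close> and a given set of \<open>l\<close> edge labels correspond, after relabelling, to the members of \<open>F\<close> with
  \<open>k\<close> vertices and \<open>l\<close> edges; this yields the binomial coefficients. Completing \<open>H\<close> to \<open>G\<close> means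
  distributing the \<open>2j = 2(m - l)\<close> ends of the remaining edges freely over the \<open>n\<close> vertices. A vertex
  of degree \<open>d\<close> in \<open>H\<close> that receives \<open>i\<close> further ends has weight \<open>\<delta> (d + i)\<close>, and the sequence
  \<open>\<delta> (d + i)\<close> has exponential generating function the \<open>d\<close>-th derivative of \<open>\<Delta>\<close>. So the total weight
  of the completions is \<open>(2j)!\<close> times the coefficient of \<open>x^(2j)\<close> in a product of such derivatives.
\<close>

section \<open>Power series and substitution\<close>

lemma fps_deriv_prod:
  fixes f :: "'a \<Rightarrow> 'b::comm_ring_1 fps"
  assumes "finite V"
  shows "fps_deriv (\<Prod>v\<in>V. f v) = (\<Sum>y\<in>V. fps_deriv (f y) * (\<Prod>v\<in>V - {y}. f v))"
  using assms
proof (induction V rule: finite_induct)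
  case (insert x V)
  have "(\<Prod>v\<in>insert x V - {y}. f v) = f x * (\<Prod>v\<in>V - {y}. f v)" if "y \<in> V" for y
  proof -
    have "insert x V - {y} = insert x (V - {y})"
      using insert that by auto
    then show ?thesis
      using insert by simp
  qed
  then have "(\<Sum>y\<in>V. fps_deriv (f y) * (\<Prod>v\<in>insert x V - {y}. f v)) =
      f x * fps_deriv (\<Prod>v\<in>V. f v)"
    by (simp add: insert.IH sum_distrib_left mult.left_commute cong: sum.cong)
  with insert show ?case
    by (simp add: algebra_simps)
qed simp

text \<open>The factor produced by differentiation cancels against the factorial in the denominator,
  so only a shift of the weight sequence remains.\<close>

lemma fps_deriv_Delta: "fps_deriv (Delta \<delta>) = Delta (\<lambda>d. \<delta> (Suc d))"
  by (simp add: Delta_def fps_eq_iff field_simps del: of_nat_Suc)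

lemma fps_deriv_funpow_Delta: "(fps_deriv ^^ k) (Delta \<delta>) = Delta (\<lambda>d. \<delta> (d + k))"
  by (induction k arbitrary: \<delta>) (simp_all add: fps_deriv_Delta)

text \<open>
  The multinomial theorem for exponential generating functions. Adding an element to \<open>S\<close>
  shifts one of the sequences \<open>a v\<close>, which is what the product rule does on the other side.
\<close>

lemma sum_PiE_prod_card_fibres:
  fixes a :: "'v \<Rightarrow> nat \<Rightarrow> real"
  assumes "finite S" "finite V"
  shows "(\<Sum>g\<in>S \<rightarrow>\<^sub>E V. \<Prod>v\<in>V. a v (card {s\<in>S. g s = v})) =
    fact (card S) * fps_nth (\<Prod>v\<in>V. Delta (a v)) (card S)"
  using assms(1)
proof (induction S arbitrary: a rule: finite_induct)
  case empty
  have "fps_nth (\<Prod>v\<in>V. Delta (a v)) 0 = (\<Prod>v\<in>V. a v 0)"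
    using assms(2) by (induction V rule: finite_induct) (simp_all add: Delta_def)
  then show ?case
    by simp
next
  case (insert s S)
  \<comment> \<open>\<open>?shift y\<close> accounts for \<open>s\<close> being sent to
    \<open>y\<close>: the fibre over \<open>y\<close> gains one element before \<open>S\<close> is
    distributed.\<close>
  let ?shift = "\<lambda>y. a(y := \<lambda>d. a y (Suc d))"
  have fibre: "a v (card {s'\<in>insert s S. (g(s := y)) s' = v}) = ?shift y v (card {s\<in>S. g s = v})"
    for y g v
  proof -
    have "{s'\<in>insert s S. (g(s := y)) s' = v} =
        (if v = y then insert s {s\<in>S. g s = v} else {s\<in>S. g s = v})"
      using insert.hyps by auto
    then show ?thesis
      using insert.hyps by simp
  qed
  have shift: "(\<Prod>v\<in>V. Delta (?shift y v)) = fps_deriv (Delta (a y)) * (\<Prod>v\<in>V - {y}. Delta (a v))"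
    if "y \<in> V" for y
    using that assms(2) by (simp add: prod.remove[of V y] fps_deriv_Delta)
  have "(\<Sum>g\<in>insert s S \<rightarrow>\<^sub>E V. \<Prod>v\<in>V. a v (card {s'\<in>insert s S. g s' = v})) =
      (\<Sum>(y, g)\<in>V \<times> (S \<rightarrow>\<^sub>E V). \<Prod>v\<in>V. ?shift y v (card {s\<in>S. g s = v}))"
    unfolding PiE_insert_eq
    by (subst sum.reindex[OF inj_combinator[OF insert.hyps(2)]])
      (simp only: fibre case_prod_unfold o_def)
  also have "\<dots> = (\<Sum>y\<in>V. fact (card S) * fps_nth (\<Prod>v\<in>V. Delta (?shift y v)) (card S))"
    by (simp only: insert.IH sum.cartesian_product[symmetric])
  also have "\<dots> = fact (card S) * fps_nth (fps_deriv (\<Prod>v\<in>V. Delta (a v))) (card S)"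
    by (simp add: shift fps_deriv_prod[OF assms(2)] fps_sum_nth sum_distrib_left
        del: fps_deriv_nth fun_upd_apply cong: sum.cong)
  \<comment> \<open>Coefficient \<open>c\<close> of a derivative is \<open>c + 1\<close> times
    coefficient \<open>c + 1\<close> of the original series, which turns \<open>fact c\<close> into
    \<open>fact (c + 1)\<close>.\<close>
  also have "\<dots> = fact (card (insert s S)) * fps_nth (\<Prod>v\<in>V. Delta (a v)) (card (insert s S))"
    using insert.hyps by simp
  finally show ?case .
qed

section \<open>Substituting power series for the variables of a polynomial\<close>

lemma y_subst_eq_sum:
  assumes "finite T" "Poly_Mapping.keys p \<subseteq> T"
  shows "y_subst g p = (\<Sum>t\<in>T. fps_const (Poly_Mapping.lookup p t) *
    (\<Prod>d\<in>Poly_Mapping.keys t. g d ^ Poly_Mapping.lookup t d))"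
  unfolding y_subst_def using assms
  by (intro sum.mono_neutral_left) (auto simp: in_keys_iff)

lemma y_subst_0: "y_subst g 0 = 0"
  by (simp add: y_subst_def)

text \<open>All three supports lie in the union of those of \<open>p\<close> and \<open>q\<close>,
  and over this common index set the sum is linear in the coefficients.\<close>

lemma y_subst_add: "y_subst g (p + q) = y_subst g p + y_subst g q"
  by (subst (1 2 3) y_subst_eq_sum[of "Poly_Mapping.keys p \<union> Poly_Mapping.keys q"])
    (use Poly_Mapping.keys_add[of p q] in
      \<open>auto simp: lookup_add algebra_simps sum.distrib fps_const_add[symmetric] simp del: fps_const_add\<close>)

lemma y_subst_sum: "y_subst g (\<Sum>i\<in>A. p i) = (\<Sum>i\<in>A. y_subst g (p i))"
  by (induction A rule: infinite_finite_induct) (simp_all add: y_subst_0 y_subst_add)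

text \<open>Variables outside the support of a monomial have exponent 0 and contribute 1, so all
  three products may range over the joint support.\<close>

lemma prod_power_lookup_add:
  fixes g :: "nat \<Rightarrow> real fps" and s t :: "nat \<Rightarrow>\<^sub>0 nat"
  shows "(\<Prod>d\<in>Poly_Mapping.keys (s + t). g d ^ Poly_Mapping.lookup (s + t) d) =
    (\<Prod>d\<in>Poly_Mapping.keys s. g d ^ Poly_Mapping.lookup s d) *
    (\<Prod>d\<in>Poly_Mapping.keys t. g d ^ Poly_Mapping.lookup t d)"
proof -
  let ?D = "Poly_Mapping.keys s \<union> Poly_Mapping.keys t"
  have *: "(\<Prod>d\<in>Poly_Mapping.keys u. g d ^ Poly_Mapping.lookup u d) =
      (\<Prod>d\<in>?D. g d ^ Poly_Mapping.lookup u d)" if "Poly_Mapping.keys u \<subseteq> ?D" for u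
    using that by (intro prod.mono_neutral_left) (auto simp: in_keys_iff)
  show ?thesis
    unfolding *[OF Poly_Mapping.keys_add] *[OF Un_upper1] *[OF Un_upper2]
    by (simp add: lookup_add power_add prod.distrib)
qed

lemma prod_y_var:
  "(\<Prod>i\<in>A. y_var (d i)) = Poly_Mapping.single (\<Sum>i\<in>A. Poly_Mapping.single (d i) 1) 1"
  by (induction A rule: infinite_finite_induct) (simp_all add: y_var_def mult_single)

text \<open>A member \<open>H\<close> contributes one monomial with a constant to the generating
  function, so multiplicativity on monomials suffices.\<close>

lemma y_subst_prod_y_var:
  assumes "finite A"
  shows "y_subst g ((\<Prod>i\<in>A. y_var (d i)) * y_const c) = fps_const c * (\<Prod>i\<in>A. g (d i))"
proof -
  have "(\<Prod>e\<in>Poly_Mapping.keys (\<Sum>i\<in>A. Poly_Mapping.single (d i) (1::nat)).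
      g e ^ Poly_Mapping.lookup (\<Sum>i\<in>A. Poly_Mapping.single (d i) 1) e) = (\<Prod>i\<in>A. g (d i))"
    using assms by (induction A rule: finite_induct) (simp_all add: prod_power_lookup_add)
  then show ?thesis
    by (simp add: prod_y_var y_const_def mult_single y_subst_def)
qed

text \<open>Convergence in this topology makes each coefficient of the partial sums eventually
  constant, and terms with \<open>j > k\<close> do not reach coefficient \<open>k\<close>.\<close>

lemma fps_nth_suminf_fps_X_power:
  fixes B :: "nat \<Rightarrow> 'a::comm_ring_1 fps"
  shows "fps_nth (suminf (\<lambda>j. B j * fps_X ^ j)) k = (\<Sum>j\<le>k. fps_nth (B j) (k - j))"
proof -
  have "(\<lambda>N. \<Sum>j<N. B j * fps_X ^ j) \<longlonglongrightarrow> (suminf (\<lambda>j. B j * fps_X ^ j))"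
    using summable_fps_X_power by (rule summable_LIMSEQ)
  then have "\<forall>\<^sub>F N in sequentially. fps_nth (\<Sum>j<N. B j * fps_X ^ j) k = fps_nth (suminf (\<lambda>j. B j * fps_X ^ j)) k"
    unfolding tendsto_fps_iff by blast
  \<comment> \<open>A single \<open>N\<close> is wanted at which coefficient \<open>k\<close> has
    reached its limit and all \<open>j \<le> k\<close> are already summed.\<close>
  then have "\<forall>\<^sub>F N in sequentially. fps_nth (\<Sum>j<N. B j * fps_X ^ j) k = fps_nth (suminf (\<lambda>j. B j * fps_X ^ j)) k \<and> k < N"
    using eventually_gt_at_top[of k] by (rule eventually_conj)
  then obtain N where N: "fps_nth (\<Sum>j<N. B j * fps_X ^ j) k = fps_nth (suminf (\<lambda>j. B j * fps_X ^ j)) k" "k < N"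
    by (auto simp: eventually_sequentially)
  have "(\<Sum>j<N. fps_nth (B j * fps_X ^ j) k) = (\<Sum>j\<le>k. fps_nth (B j * fps_X ^ j) k)"
    using N(2) by (intro sum.mono_neutral_right) (auto simp: fps_X_power_mult_right_nth)
  also have "\<dots> = (\<Sum>j\<le>k. fps_nth (B j) (k - j))"
    by (intro sum.cong) (auto simp: fps_X_power_mult_right_nth)
  finally show ?thesis
    using N(1) by (simp add: fps_sum_nth)
qed

section \<open>Relabelling\<close>

definition relabel_edge :: "(int \<Rightarrow> int) \<Rightarrow> (int \<Rightarrow> int) \<Rightarrow> int \<times> int \<times> int \<Rightarrow> int \<times> int \<times> int"
  where "relabel_edge \<phi> \<psi> = (\<lambda>(v, w, e). (\<phi> v, \<phi> w, \<psi> e))"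

text \<open>Defined for arbitrary functions, so that relabellings compose without side conditions;
  injectivity is stated separately where it matters.\<close>

definition relabel :: "(int \<Rightarrow> int) \<Rightarrow> (int \<Rightarrow> int) \<Rightarrow> multigraph \<Rightarrow> multigraph"
  where "relabel \<phi> \<psi> G = Multigraph (\<phi> ` verts G) (relabel_edge \<phi> \<psi> ` edges G)"

abbreviation edge_labels :: "multigraph \<Rightarrow> int set"
  where "edge_labels G \<equiv> edge_label ` edges G"

lemma relabel_edge_simps [simp]:
  "edge_src (relabel_edge \<phi> \<psi> a) = \<phi> (edge_src a)"
  "edge_tgt (relabel_edge \<phi> \<psi> a) = \<phi> (edge_tgt a)"
  "edge_label (relabel_edge \<phi> \<psi> a) = \<psi> (edge_label a)"
  by (cases a; simp add: relabel_edge_def edge_src_def edge_tgt_def edge_label_def)+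

lemma edge_eqI: "edge_src a = edge_src b \<Longrightarrow> edge_tgt a = edge_tgt b \<Longrightarrow> edge_label a = edge_label b \<Longrightarrow> a = b"
  by (cases a; cases b) (simp add: edge_src_def edge_tgt_def edge_label_def)

lemma verts_relabel [simp]: "verts (relabel \<phi> \<psi> G) = \<phi> ` verts G"
  and edges_relabel [simp]: "edges (relabel \<phi> \<psi> G) = relabel_edge \<phi> \<psi> ` edges G"
  by (simp_all add: relabel_def)

lemma edge_labels_relabel: "edge_labels (relabel \<phi> \<psi> G) = \<psi> ` edge_labels G"
  by (simp add: image_image)

lemma relabel_compose: "relabel \<phi>' \<psi>' (relabel \<phi> \<psi> G) = relabel (\<phi>' \<circ> \<phi>) (\<psi>' \<circ> \<psi>) G"
  by (simp add: relabel_def relabel_edge_def image_image case_prod_unfold)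

text \<open>Well-formedness puts the ends of every edge in \<open>verts G\<close>, where
  \<open>\<phi>\<close> is the identity, so each edge is fixed as well.\<close>

lemma relabel_id:
  assumes "wf_multigraph G" "\<And>v. v \<in> verts G \<Longrightarrow> \<phi> v = v" "\<And>e. e \<in> edge_labels G \<Longrightarrow> \<psi> e = e"
  shows "relabel \<phi> \<psi> G = G"
proof -
  have "relabel_edge \<phi> \<psi> a = a" if "a \<in> edges G" for a
    by (rule edge_eqI) (use assms that in \<open>auto simp: wf_multigraph_def\<close>)
  then show ?thesis
    using assms(2) by (simp add: relabel_def cong: image_cong)
qed

text \<open>Since \<open>H\<close> is an image of \<open>G\<close>, the bijections reduce to
  injections; isomorphisms can then be composed and inverted as equations.\<close>

lemma isomorphic_iff_relabel:
  "isomorphic G H \<longleftrightarrow>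
    (\<exists>\<phi> \<psi>. inj_on \<phi> (verts G) \<and> inj_on \<psi> (edge_labels G) \<and> H = relabel \<phi> \<psi> G)"
proof
  assume "isomorphic G H"
  then show "\<exists>\<phi> \<psi>. inj_on \<phi> (verts G) \<and> inj_on \<psi> (edge_labels G) \<and> H = relabel \<phi> \<psi> G"
    unfolding isomorphic_def relabel_def relabel_edge_def
    by (metis bij_betw_def multigraph.collapse)
next
  assume "\<exists>\<phi> \<psi>. inj_on \<phi> (verts G) \<and> inj_on \<psi> (edge_labels G) \<and> H = relabel \<phi> \<psi> G"
  then obtain \<phi> \<psi> where *: "inj_on \<phi> (verts G)" "inj_on \<psi> (edge_labels G)" "H = relabel \<phi> \<psi> G"
    by blast
  then have "bij_betw \<phi> (verts G) (verts H)" "bij_betw \<psi> (edge_labels G) (edge_labels H)"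
    using edge_labels_relabel[of \<phi> \<psi> G] by (auto simp: bij_betw_def)
  with *(3) show "isomorphic G H"
    unfolding isomorphic_def by (auto simp: relabel_edge_def)
qed

lemma isomorphic_trans: "isomorphic G H \<Longrightarrow> isomorphic H K \<Longrightarrow> isomorphic G K"
proof -
  assume "isomorphic G H" "isomorphic H K"
  then obtain \<phi> \<psi> \<phi>' \<psi>' where G: "inj_on \<phi> (verts G)" "inj_on \<psi> (edge_labels G)" "H = relabel \<phi> \<psi> G"
    and H: "inj_on \<phi>' (verts H)" "inj_on \<psi>' (edge_labels H)" "K = relabel \<phi>' \<psi>' H"
    unfolding isomorphic_iff_relabel by blast
  have "inj_on (\<phi>' \<circ> \<phi>) (verts G)"
    using G H(1) by (intro comp_inj_on) simp_all
  moreover have "inj_on (\<psi>' \<circ> \<psi>) (edge_labels G)"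
    using G(2) H(2) unfolding G(3) edge_labels_relabel by (rule comp_inj_on)
  moreover have "K = relabel (\<phi>' \<circ> \<phi>) (\<psi>' \<circ> \<psi>) G"
    by (simp add: G(3) H(3) relabel_compose)
  ultimately show "isomorphic G K"
    unfolding isomorphic_iff_relabel by blast
qed

lemma relabel_inverse:
  assumes "wf_multigraph G" "inj_on \<phi> (verts G)" "inj_on \<psi> (edge_labels G)"
  shows "relabel (inv_into (verts G) \<phi>) (inv_into (edge_labels G) \<psi>) (relabel \<phi> \<psi> G) = G"
  unfolding relabel_compose by (rule relabel_id) (use assms in auto)

lemma isomorphic_sym:
  assumes "wf_multigraph G" "isomorphic G H"
  shows "isomorphic H G"
proof -
  obtain \<phi> \<psi> where *: "inj_on \<phi> (verts G)" "inj_on \<psi> (edge_labels G)" "H = relabel \<phi> \<psi> G"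
    using assms(2) by (auto simp: isomorphic_iff_relabel)
  then have "G = relabel (inv_into (verts G) \<phi>) (inv_into (edge_labels G) \<psi>) H"
    using assms(1) by (simp add: relabel_inverse)
  moreover have "inj_on (inv_into (verts G) \<phi>) (verts H)"
    using *(3) by (auto intro: inj_on_inv_into)
  moreover have "inj_on (inv_into (edge_labels G) \<psi>) (edge_labels H)"
    unfolding *(3) edge_labels_relabel by (rule inj_on_inv_into) simp
  ultimately show ?thesis
    unfolding isomorphic_iff_relabel by blast
qed

lemma wf_relabel:
  assumes "wf_multigraph G" "inj_on \<psi> (edge_labels G)"
  shows "wf_multigraph (relabel \<phi> \<psi> G)"
proof -
  have "inj_on (\<psi> \<circ> edge_label) (edges G)"
    using assms by (intro comp_inj_on) (auto simp: wf_multigraph_def)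
  then have "inj_on edge_label (relabel_edge \<phi> \<psi> ` edges G)"
    by (intro inj_on_imageI) (simp add: comp_def)
  then show ?thesis
    using assms(1) by (auto simp: wf_multigraph_def)
qed

text \<open>Labels determine edges, so relabelling is injective on edges; injectivity on vertices
  makes the ends at \<open>\<phi> v\<close> the images of those at \<open>v\<close>.\<close>

lemma deg_relabel:
  assumes "wf_multigraph G" "inj_on \<phi> (verts G)" "inj_on \<psi> (edge_labels G)" "v \<in> verts G"
  shows "deg (relabel \<phi> \<psi> G) (\<phi> v) = deg G v"
proof -
  have inj: "inj_on (relabel_edge \<phi> \<psi>) (edges G)"
  proof (rule inj_onI)
    fix a b assume ab: "a \<in> edges G" "b \<in> edges G" "relabel_edge \<phi> \<psi> a = relabel_edge \<phi> \<psi> b"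
    then have "\<psi> (edge_label a) = \<psi> (edge_label b)"
      by (metis relabel_edge_simps(3))
    then have "edge_label a = edge_label b"
      using assms(3) ab by (auto dest: inj_onD)
    then show "a = b"
      using assms(1) ab by (auto simp: wf_multigraph_def dest: inj_onD)
  qed
  \<comment> \<open>\<open>f\<close> stands for \<open>edge_src\<close> or \<open>edge_tgt\<close>,
    so that one argument serves both ends.\<close>
  have *: "card {a\<in>relabel_edge \<phi> \<psi> ` edges G. f a = \<phi> v} = card {a\<in>edges G. f a = v}"
    if "\<And>a. f (relabel_edge \<phi> \<psi> a) = \<phi> (f a)" "\<And>a. a \<in> edges G \<Longrightarrow> f a \<in> verts G" for f
  proof -
    have "{a\<in>relabel_edge \<phi> \<psi> ` edges G. f a = \<phi> v} = relabel_edge \<phi> \<psi> ` {a\<in>edges G. f a = v}"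
      using that inj_on_eq_iff[OF assms(2) _ assms(4)] by (force intro!: image_eqI)
    then show ?thesis
      using inj by (simp add: card_image inj_on_subset)
  qed
  show ?thesis
    unfolding deg_def using assms(1) by (simp add: * wf_multigraph_def)
qed

section \<open>Copies of family members on prescribed label sets\<close>

lemma card_edge_labels: "wf_multigraph G \<Longrightarrow> card (edge_labels G) = card (edges G)"
  by (simp add: card_image wf_multigraph_def)

text \<open>Independent of any surrounding multigraph, so that \<open>H\<close> can be chosen before
  \<open>G\<close>.\<close>

definition labelled_copies :: "multigraph set \<Rightarrow> int set \<Rightarrow> int set \<Rightarrow> multigraph set"
  where "labelled_copies F V L =
    {H. wf_multigraph H \<and> verts H = V \<and> edge_labels H = L \<and> (\<exists>K\<in>F. isomorphic H K)}"

lemma relabel_labelled_copies: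
  assumes "inj_on \<phi> V" "inj_on \<psi> L" "H \<in> labelled_copies F V L"
  shows "relabel \<phi> \<psi> H \<in> labelled_copies F (\<phi> ` V) (\<psi> ` L)"
proof -
  from assms(3) obtain K where H: "wf_multigraph H" "verts H = V" "edge_labels H = L"
    and K: "K \<in> F" "isomorphic H K"
    by (auto simp: labelled_copies_def)
  have "isomorphic H (relabel \<phi> \<psi> H)"
    using assms H by (auto simp: isomorphic_iff_relabel)
  then have "isomorphic (relabel \<phi> \<psi> H) K"
    using isomorphic_sym[OF H(1)] isomorphic_trans K(2) by blast
  then show ?thesis
    using assms H K wf_relabel[OF H(1), of \<psi> \<phi>]
    by (auto simp: labelled_copies_def edge_labels_relabel simp del: edges_relabel)
qed

text \<open>On initial segments a copy is canonically labelled, so closure under isomorphism puts it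
  into \<open>F\<close>; conversely, the two cardinalities determine the label sets of a
  member.\<close>

lemma labelled_copies_canonical:
  assumes "multigraph_family F"
  shows "labelled_copies F {1..int k} {1..int l} = {H\<in>F. card (verts H) = k \<and> card (edges H) = l}"
proof (intro equalityI subsetI)
  fix H assume "H \<in> labelled_copies F {1..int k} {1..int l}"
  then obtain K where H: "wf_multigraph H" "verts H = {1..int k}" "edge_labels H = {1..int l}"
    and K: "K \<in> F" "isomorphic H K"
    by (auto simp: labelled_copies_def)
  have "H \<in> F"
    using assms K isomorphic_sym[OF H(1) K(2)] H
    unfolding multigraph_family_def nm_multigraph_def by blast
  moreover have "card (verts H) = k" "card (edges H) = l"
    using H card_edge_labels[OF H(1)] by simp_all
  ultimately show "H \<in> {H\<in>F. card (verts H) = k \<and> card (edges H) = l}"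
    by simp
next
  fix H assume H: "H \<in> {H\<in>F. card (verts H) = k \<and> card (edges H) = l}"
  then obtain n m where nm: "nm_multigraph n m H"
    using assms by (auto simp: multigraph_family_def)
  then have "n = k" "m = l"
    using H card_edge_labels[of H] by (auto simp: nm_multigraph_def)
  moreover have "isomorphic H H"
    unfolding isomorphic_iff_relabel using nm
    by (intro exI[of _ id]) (simp add: relabel_id nm_multigraph_def)
  ultimately show "H \<in> labelled_copies F {1..int k} {1..int l}"
    using H nm by (auto simp: labelled_copies_def nm_multigraph_def)
qed

text \<open>Relabelling along bijections onto initial segments preserves degrees, so
  \<open>V\<close> and \<open>L\<close> matter only through their sizes. The map \<open>h\<close>
  leaves room for a further factor and the extraction of a coefficient.\<close>

lemma sum_labelled_copies:
  fixes c :: "nat \<Rightarrow> 'a::comm_monoid_mult" and h :: "'a \<Rightarrow> 'b::comm_monoid_add"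
  assumes F: "multigraph_family F" and "finite V" "finite L"
  shows "(\<Sum>H\<in>labelled_copies F V L. h (\<Prod>v\<in>verts H. c (deg H v))) =
    (\<Sum>H | H \<in> F \<and> card (verts H) = card V \<and> card (edges H) = card L.
      h (\<Prod>v\<in>verts H. c (deg H v)))"
proof -
  obtain \<phi> where \<phi>: "bij_betw \<phi> V {1..int (card V)}"
    using finite_same_card_bij[OF \<open>finite V\<close>, of "{1..int (card V)}"] by auto
  obtain \<psi> where \<psi>: "bij_betw \<psi> L {1..int (card L)}"
    using finite_same_card_bij[OF \<open>finite L\<close>, of "{1..int (card L)}"] by auto
  let ?\<phi>' = "inv_into V \<phi>" and ?\<psi>' = "inv_into L \<psi>"
  have inv: "bij_betw ?\<phi>' {1..int (card V)} V" "bij_betw ?\<psi>' {1..int (card L)} L"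
    using \<phi> \<psi> by (auto intro: bij_betw_inv_into)
  have "(\<Sum>H\<in>labelled_copies F V L. h (\<Prod>v\<in>verts H. c (deg H v))) =
      (\<Sum>H\<in>labelled_copies F {1..int (card V)} {1..int (card L)}. h (\<Prod>v\<in>verts H. c (deg H v)))"
  proof (rule sum.reindex_bij_witness[of _ "relabel ?\<phi>' ?\<psi>'" "relabel \<phi> \<psi>"])
    fix H assume H: "H \<in> labelled_copies F V L"
    then have wf: "wf_multigraph H" "verts H = V" "edge_labels H = L"
      by (auto simp: labelled_copies_def)
    show "relabel ?\<phi>' ?\<psi>' (relabel \<phi> \<psi> H) = H"
      using relabel_inverse[OF wf(1), of \<phi> \<psi>] \<phi> \<psi> wf by (simp add: bij_betw_def)
    show "relabel \<phi> \<psi> H \<in> labelled_copies F {1..int (card V)} {1..int (card L)}"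
      using relabel_labelled_copies[OF _ _ H, of \<phi> \<psi>] \<phi> \<psi> by (simp add: bij_betw_def)
    have "(\<Prod>v\<in>verts (relabel \<phi> \<psi> H). c (deg (relabel \<phi> \<psi> H) v)) = (\<Prod>v\<in>verts H. c (deg H v))"
      using \<phi> \<psi> unfolding verts_relabel bij_betw_def
      by (subst prod.reindex) (simp_all add: wf deg_relabel)
    then show "h (\<Prod>v\<in>verts (relabel \<phi> \<psi> H). c (deg (relabel \<phi> \<psi> H) v)) =
        h (\<Prod>v\<in>verts H. c (deg H v))"
      by simp
  next
    fix H assume H: "H \<in> labelled_copies F {1..int (card V)} {1..int (card L)}"
    then have wf: "wf_multigraph H" "verts H = {1..int (card V)}" "edge_labels H = {1..int (card L)}"
      by (auto simp: labelled_copies_def)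
    show "relabel \<phi> \<psi> (relabel ?\<phi>' ?\<psi>' H) = H"
      unfolding relabel_compose using \<phi> \<psi>
      by (intro relabel_id) (auto simp: wf bij_betw_inv_into_right)
    show "relabel ?\<phi>' ?\<psi>' H \<in> labelled_copies F V L"
      using relabel_labelled_copies[OF _ _ H, of ?\<phi>' ?\<psi>'] inv by (simp add: bij_betw_def)
  qed
  then show ?thesis
    by (simp add: labelled_copies_canonical[OF F])
qed

section \<open>Completing a subgraph\<close>

text \<open>The flag tells source (\<open>False\<close>) from target (\<open>True\<close>). A
  completion thus becomes a function on a set of edge ends, the form that
  \<open>sum_PiE_prod_card_fibres\<close> handles.\<close>

definition attach :: "multigraph \<Rightarrow> int set \<Rightarrow> int set \<Rightarrow> (int \<times> bool \<Rightarrow> int) \<Rightarrow> multigraph"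
  where "attach H V C g = Multigraph V (edges H \<union> (\<lambda>e. (g (e, False), g (e, True), e)) ` C)"

text \<open>The new edges differ from those of \<open>H\<close> by their labels. The ends they add
  at \<open>v\<close> form the fibre of \<open>g\<close> over \<open>v\<close>, in which a loop
  counts with both ends.\<close>

lemma deg_attach:
  assumes "finite C" "finite (edges H)" "edge_labels H \<inter> C = {}"
  shows "deg (attach H V C g) v = deg H v + card {s\<in>C \<times> UNIV. g s = v}"
proof -
  let ?n = "\<lambda>e. (g (e, False), g (e, True), e)"
  \<comment> \<open>To be used with \<open>edge_src\<close> and \<open>False\<close>, and with
    \<open>edge_tgt\<close> and \<open>True\<close>.\<close>
  have *: "card {a\<in>edges H \<union> ?n ` C. f a = v} = card {a\<in>edges H. f a = v} + card {e\<in>C. g (e, b) = v}"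
    if f: "\<And>e. f (?n e) = g (e, b)" for f b
  proof -
    have "{a\<in>edges H \<union> ?n ` C. f a = v} = {a\<in>edges H. f a = v} \<union> ?n ` {e\<in>C. g (e, b) = v}"
      using f by auto
    moreover have "{a\<in>edges H. f a = v} \<inter> ?n ` {e\<in>C. g (e, b) = v} = {}"
      using assms(3) by (force simp: edge_label_def)
    moreover have "card (?n ` {e\<in>C. g (e, b) = v}) = card {e\<in>C. g (e, b) = v}"
      by (intro card_image inj_onI) auto
    ultimately show ?thesis
      using assms by (simp add: card_Un_disjoint)
  qed
  have "{s\<in>C \<times> UNIV. g s = v} =
      (\<lambda>e. (e, False)) ` {e\<in>C. g (e, False) = v} \<union> (\<lambda>e. (e, True)) ` {e\<in>C. g (e, True) = v}"
    by (auto simp: image_iff) (metis (full_types))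
  moreover have "card ((\<lambda>e. (e, b)) ` {e\<in>C. g (e, b) = v}) = card {e\<in>C. g (e, b) = v}" for b :: bool
    by (intro card_image inj_onI) auto
  moreover have "card ((\<lambda>e. (e, False)) ` {e\<in>C. g (e, False) = v} \<union> (\<lambda>e. (e, True)) ` {e\<in>C. g (e, True) = v}) =
      card ((\<lambda>e. (e, False)) ` {e\<in>C. g (e, False) = v}) + card ((\<lambda>e. (e, True)) ` {e\<in>C. g (e, True) = v})"
    using assms(1) by (intro card_Un_disjoint) auto
  ultimately have "card {s\<in>C \<times> UNIV. g s = v} = card {e\<in>C. g (e, False) = v} + card {e\<in>C. g (e, True) = v}"
    by simp
  then show ?thesis
    using *[of edge_src False] *[of edge_tgt True]
    by (simp add: deg_def attach_def edge_src_def edge_tgt_def)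
qed

text \<open>In a completion each missing label belongs to exactly one edge, whose ends are arbitrary
  vertices; extensionality makes the function recording these ends unique.\<close>

lemma bij_betw_attach:
  assumes H: "wf_multigraph H" "verts H \<subseteq> {1..int n}" "edge_labels H \<subseteq> {1..int m}"
    and C: "C = {1..int m} - edge_labels H"
  shows "bij_betw (attach H {1..int n} C) (C \<times> UNIV \<rightarrow>\<^sub>E {1..int n})
    {G. nm_multigraph n m G \<and> edges H \<subseteq> edges G}"
proof (rule bij_betw_imageI)
  let ?n = "\<lambda>g e. (g (e, False), g (e, True), e) :: int \<times> int \<times> int"
  have disj: "?n g e \<notin> edges H" if "e \<in> C" for g e
    using that unfolding C by (force simp: edge_label_def)
  show "inj_on (attach H {1..int n} C) (C \<times> UNIV \<rightarrow>\<^sub>E {1..int n})"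
  proof (rule inj_onI)
    fix g g' assume g: "g \<in> C \<times> UNIV \<rightarrow>\<^sub>E {1..int n}" "g' \<in> C \<times> UNIV \<rightarrow>\<^sub>E {1..int n}"
      and eq: "attach H {1..int n} C g = attach H {1..int n} C g'"
    have "g (e, b) = g' (e, b)" if "e \<in> C" for e b
    proof -
      \<comment> \<open>The new edge labelled \<open>e\<close> is not in \<open>H\<close>, so it is
        a new edge for \<open>g'\<close> too; its label singles it out, and the ends agree.\<close>
      have "?n g e \<in> ?n g' ` C"
        using eq disj[OF that, of g] that by (auto simp: attach_def)
      then show ?thesis
        by (cases b) auto
    qed
    then show "g = g'"
      by (intro PiE_ext[OF g]) auto
  qed
  show "attach H {1..int n} C ` (C \<times> UNIV \<rightarrow>\<^sub>E {1..int n}) =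
      {G. nm_multigraph n m G \<and> edges H \<subseteq> edges G}"
  proof (intro equalityI subsetI)
    fix G assume "G \<in> attach H {1..int n} C ` (C \<times> UNIV \<rightarrow>\<^sub>E {1..int n})"
    then obtain g where g: "g \<in> C \<times> UNIV \<rightarrow>\<^sub>E {1..int n}" and G: "G = attach H {1..int n} C g"
      by blast
    have label: "edge_label (?n g e) = e" for e
      by (simp add: edge_label_def)
    have ends: "g (e, b) \<in> {1..int n}" if "e \<in> C" for e b
      using PiE_mem[OF g, of "(e, b)"] that by simp
    have "edge_labels G = edge_labels H \<union> C"
      by (simp add: G attach_def image_Un image_image label)
    moreover have "inj_on edge_label (edges G)"
    proof (unfold G attach_def multigraph.sel, subst inj_on_Un, intro conjI)
      show "inj_on edge_label (edges H)"
        using H(1) by (simp add: wf_multigraph_def)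
      show "inj_on edge_label (?n g ` C)"
        by (intro inj_on_imageI) (simp add: comp_def label inj_on_def)
      show "edge_label ` (edges H - ?n g ` C) \<inter> edge_label ` (?n g ` C - edges H) = {}"
        unfolding C by (auto simp: label)
    qed
    moreover have "finite C"
      by (simp add: C)
    moreover have "edge_src a \<in> {1..int n} \<and> edge_tgt a \<in> {1..int n}" if "a \<in> edges G" for a
    proof (cases "a \<in> edges H")
      case True
      then show ?thesis
        using H by (meson subsetD wf_multigraph_def)
    next
      case False
      then obtain e where "e \<in> C" "a = ?n g e"
        using \<open>a \<in> edges G\<close> by (auto simp: G attach_def)
      then show ?thesis
        using ends by (simp add: edge_src_def edge_tgt_def)
    qed
    moreover have "finite (edges G)"
      using H(1) \<open>finite C\<close> by (simp add: G attach_def wf_multigraph_def)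
    moreover have "edge_labels H \<union> C = {1..int m}"
      using H(3) unfolding C by blast
    ultimately have "nm_multigraph n m G"
      by (simp add: nm_multigraph_def wf_multigraph_def G attach_def)
    then show "G \<in> {G. nm_multigraph n m G \<and> edges H \<subseteq> edges G}"
      by (simp add: G attach_def)
  next
    fix G assume "G \<in> {G. nm_multigraph n m G \<and> edges H \<subseteq> edges G}"
    then have G: "nm_multigraph n m G" "edges H \<subseteq> edges G"
      by auto
    have wf: "wf_multigraph G" "verts G = {1..int n}" "edge_labels G = {1..int m}"
      using G(1) by (auto simp: nm_multigraph_def)
    \<comment> \<open>For \<open>e\<close> in \<open>C\<close>, \<open>a e\<close> is the edge of
      \<open>G\<close> with label \<open>e\<close>, and \<open>g\<close> reads off its two
      ends.\<close>
    define a where "a e = inv_into (edges G) edge_label e" for e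
    define g where "g = (\<lambda>(e, b)\<in>C \<times> UNIV. if b then edge_tgt (a e) else edge_src (a e))"
    have a: "a e \<in> edges G" "edge_label (a e) = e" if "e \<in> C" for e
      using that wf(3) unfolding C a_def by (auto intro: inv_into_into f_inv_into_f)
    have n: "?n g e = a e" if "e \<in> C" for e
      using that a[OF that] by (intro edge_eqI) (simp_all add: g_def edge_src_def edge_tgt_def edge_label_def)
    have "g \<in> C \<times> UNIV \<rightarrow>\<^sub>E {1..int n}"
      using a(1) wf(1,2) unfolding g_def wf_multigraph_def by (intro PiE_I) auto
    moreover have "edges G = edges H \<union> ?n g ` C"
    proof (intro equalityI subsetI)
      fix b assume b: "b \<in> edges G"
      have *: "x = y" if "x \<in> edges G" "y \<in> edges G" "edge_label x = edge_label y" for x y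
        using wf(1) that by (auto simp: wf_multigraph_def dest: inj_onD)
      show "b \<in> edges H \<union> ?n g ` C"
      \<comment> \<open>An edge with label in \<open>C\<close> is new; any other shares its label
        with an edge of \<open>H\<close> and equals it, as labels are unique in
        \<open>G\<close>.\<close>
      proof (cases "edge_label b \<in> C")
        case True
        then have "b = ?n g (edge_label b)"
          using *[OF b] a n by simp
        with True show ?thesis
          by blast
      next
        case False
        then have "edge_label b \<in> edge_labels H"
          using b wf(3) unfolding C by blast
        then obtain b' where "b' \<in> edges H" "edge_label b = edge_label b'"
          by blast
        then show ?thesis
          using *[OF b, of b'] G(2) by auto
      qed
    qed (use G(2) a n in auto)
    then have "G = attach H {1..int n} C g"
      using wf(2) by (cases G) (simp add: attach_def)
    ultimately show "G \<in> attach H {1..int n} C ` (C \<times> UNIV \<rightarrow>\<^sub>E {1..int n})"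
      by blast
  qed
qed

text \<open>Gives the vertices of \<open>G\<close> outside \<open>H\<close> the factor
  \<open>Delta \<delta>\<close> itself, the derivative of order 0.\<close>

lemma deg_outside: "wf_multigraph H \<Longrightarrow> v \<notin> verts H \<Longrightarrow> deg H v = 0"
  by (auto simp: deg_def wf_multigraph_def)

lemma sum_weight_extensions:
  assumes H: "wf_multigraph H" "verts H \<subseteq> {1..int n}" "edge_labels H \<subseteq> {1..int m}"
  shows "(\<Sum>G | nm_multigraph n m G \<and> edges H \<subseteq> edges G. weight \<delta> G) =
    fact (2 * (m - card (edges H))) *
      fps_nth ((\<Prod>v\<in>verts H. (fps_deriv ^^ deg H v) (Delta \<delta>)) * Delta \<delta> ^ (n - card (verts H)))
        (2 * (m - card (edges H)))"
proof -
  define C where "C = {1..int m} - edge_labels H"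
  have fin: "finite (edges H)" "finite (verts H)" "finite C"
    using H(1) by (auto simp: wf_multigraph_def C_def)
  have "card C = m - card (edges H)"
    unfolding C_def using H(3) card_edge_labels[OF H(1)] by (subst card_Diff_subset) (use fin in auto)
  then have card: "card (C \<times> (UNIV :: bool set)) = 2 * (m - card (edges H))"
    by (simp add: card_cartesian_product)
  have "(\<Sum>G | nm_multigraph n m G \<and> edges H \<subseteq> edges G. weight \<delta> G) =
      (\<Sum>g\<in>C \<times> UNIV \<rightarrow>\<^sub>E {1..int n}. weight \<delta> (attach H {1..int n} C g))"
    by (rule sum.reindex_bij_betw[OF bij_betw_attach[OF H C_def], symmetric])
  also have "\<dots> = (\<Sum>g\<in>C \<times> (UNIV :: bool set) \<rightarrow>\<^sub>E {1..int n}. \<Prod>v\<in>{1..int n}.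
      \<delta> (card {s\<in>C \<times> UNIV. g s = v} + deg H v))"
    using fin by (simp add: weight_def deg_attach add.commute C_def) (simp add: attach_def)
  \<comment> \<open>The sequence used at \<open>v\<close> is \<open>\<delta>\<close> shifted by
    \<open>deg H v\<close>, whose generating function is the derivative of that order.\<close>
  also have "\<dots> = fact (2 * (m - card (edges H))) *
      fps_nth (\<Prod>v\<in>{1..int n}. (fps_deriv ^^ deg H v) (Delta \<delta>)) (2 * (m - card (edges H)))"
    using sum_PiE_prod_card_fibres[of "C \<times> (UNIV :: bool set)" "{1..int n}" "\<lambda>v d. \<delta> (d + deg H v)"] fin card
    by (simp add: fps_deriv_funpow_Delta)
  also have "(\<Prod>v\<in>{1..int n}. (fps_deriv ^^ deg H v) (Delta \<delta>)) =
      (\<Prod>v\<in>{1..int n} - verts H. (fps_deriv ^^ deg H v) (Delta \<delta>)) *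
      (\<Prod>v\<in>verts H. (fps_deriv ^^ deg H v) (Delta \<delta>))"
    using H(2) by (intro prod.subset_diff) auto
  also have "(\<Prod>v\<in>{1..int n} - verts H. (fps_deriv ^^ deg H v) (Delta \<delta>)) =
      Delta \<delta> ^ (n - card (verts H))"
    using H fin by (simp add: deg_outside card_Diff_subset)
  finally show ?thesis
    by (simp add: mult.commute)
qed

section \<open>Summing over subgraphs\<close>

lemma sum_Pow_card:
  fixes f :: "nat \<Rightarrow> real"
  assumes "finite A"
  shows "(\<Sum>V\<in>Pow A. f (card V)) = (\<Sum>k\<le>card A. of_nat (card A choose k) * f k)"
proof -
  have "(\<Sum>V\<in>Pow A. f (card V)) = (\<Sum>k\<le>card A. \<Sum>V | V \<in> Pow A \<and> card V = k. f (card V))"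
    using assms by (intro sum.group[symmetric]) (auto intro: card_mono)
  also have "\<dots> = (\<Sum>k\<le>card A. \<Sum>V | V \<subseteq> A \<and> card V = k. f k)"
    by (intro sum.cong) auto
  also have "\<dots> = (\<Sum>k\<le>card A. of_nat (card A choose k) * f k)"
    using assms by (simp add: n_subsets)
  finally show ?thesis .
qed

lemma MG_marked_eq:
  assumes F: "multigraph_family F"
  shows "MG_marked F n m \<delta> = (\<Sum>k\<le>n. of_nat (n choose k) * (\<Sum>l\<le>m. of_nat (m choose l) *
    (\<Sum>H | H \<in> F \<and> card (verts H) = k \<and> card (edges H) = l.
      fact (2 * (m - l)) *
      fps_nth ((\<Prod>v\<in>verts H. (fps_deriv ^^ deg H v) (Delta \<delta>)) * Delta \<delta> ^ (n - k)) (2 * (m - l)))))"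
    (is "_ = (\<Sum>k\<le>n. _ * (\<Sum>l\<le>m. _ * ?\<Phi> k l))")
proof -
  let ?A = "{1..int n}" and ?B = "{1..int m}"
  let ?h = "\<lambda>k l P. fact (2 * (m - l)) * fps_nth (P * Delta \<delta> ^ (n - k)) (2 * (m - l))"
  let ?P = "\<lambda>H. \<Prod>v\<in>verts H. (fps_deriv ^^ deg H v) (Delta \<delta>)"
  have copies: "finite (labelled_copies F V L)" if "V \<subseteq> ?A" "L \<subseteq> ?B" for V L
  proof (rule finite_subset)
    show "labelled_copies F V L \<subseteq> (\<lambda>E. Multigraph V E) ` Pow (V \<times> V \<times> L)"
    proof
      fix H assume H: "H \<in> labelled_copies F V L"
      have "a \<in> V \<times> V \<times> L" if "a \<in> edges H" for a
      proof -
        have "edge_src a \<in> V" "edge_tgt a \<in> V" "edge_label a \<in> L"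
          using H that by (auto simp: labelled_copies_def wf_multigraph_def)
        then show ?thesis
          by (cases a) (simp add: edge_src_def edge_tgt_def edge_label_def)
      qed
      then show "H \<in> (\<lambda>E. Multigraph V E) ` Pow (V \<times> V \<times> L)"
        using H by (intro image_eqI[of _ _ "edges H"]) (auto simp: labelled_copies_def)
    qed
    have "finite V" "finite L"
      using that by (simp_all add: finite_subset)
    then show "finite ((\<lambda>E. Multigraph V E) ` Pow (V \<times> V \<times> L))"
      by simp
  qed
  \<comment> \<open>\<open>V\<close> and \<open>L\<close> are determined by \<open>H\<close> and
    only group the pairs; \<open>G\<close> comes last, so that it is summed innermost.\<close>
  let ?T = "SIGMA V:Pow ?A. SIGMA L:Pow ?B. SIGMA H:labelled_copies F V L.
    {G. nm_multigraph n m G \<and> edges H \<subseteq> edges G}"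
  have finG: "finite {G. nm_multigraph n m G \<and> edges H \<subseteq> edges G}" for H
    by (rule finite_subset[OF _ finite_nm_multigraphs[of n m]]) auto
  have "MG_marked F n m \<delta> = (\<Sum>(V, L, H, G)\<in>?T. weight \<delta> G)"
    unfolding MG_marked_def
  proof (rule sum.reindex_bij_witness[of _ "\<lambda>(V, L, H, G). (G, H)"
        "\<lambda>(G, H). (verts H, edge_labels H, H, G)"])
    fix x assume "x \<in> {(G, H). nm_multigraph n m G \<and> F_subgraph F H G}"
    then obtain G H where x: "x = (G, H)" and G: "nm_multigraph n m G"
      and H: "wf_multigraph H" "verts H \<subseteq> verts G" "edges H \<subseteq> edges G" "\<exists>K\<in>F. isomorphic H K"
      by (auto simp: F_subgraph_def subgraph_def)
    have "edge_labels H \<subseteq> ?B"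
      using G H(3) unfolding nm_multigraph_def by blast
    then show "(case x of (G, H) \<Rightarrow> (verts H, edge_labels H, H, G)) \<in> ?T"
      using G H by (simp add: x labelled_copies_def nm_multigraph_def)
  next
    fix x assume "x \<in> ?T"
    then obtain V L H G where "x = (V, L, H, G)" "V \<subseteq> ?A" "H \<in> labelled_copies F V L"
      "nm_multigraph n m G" "edges H \<subseteq> edges G"
      by blast
    then show "(case x of (V, L, H, G) \<Rightarrow> (G, H)) \<in> {(G, H). nm_multigraph n m G \<and> F_subgraph F H G}"
      by (simp add: F_subgraph_def subgraph_def labelled_copies_def nm_multigraph_def)
  qed (auto simp: labelled_copies_def)
  also have "\<dots> = (\<Sum>V\<in>Pow ?A. \<Sum>L\<in>Pow ?B. \<Sum>H\<in>labelled_copies F V L.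
      \<Sum>G | nm_multigraph n m G \<and> edges H \<subseteq> edges G. weight \<delta> G)"
  proof -
    let ?X = "\<lambda>H. {G. nm_multigraph n m G \<and> edges H \<subseteq> edges G}"
    \<comment> \<open>Merging iterated sums by \<open>sum.Sigma\<close> calls for finite index sets
      at every level.\<close>
    have 1: "finite (SIGMA H:labelled_copies F V L. ?X H)" if "V \<subseteq> ?A" "L \<subseteq> ?B" for V L
      using copies[OF that] finG by (rule finite_SigmaI)
    have 2: "finite (SIGMA L:Pow ?B. SIGMA H:labelled_copies F V L. ?X H)" if "V \<subseteq> ?A" for V
      using that by (intro finite_SigmaI[OF _ 1]) auto
    show ?thesis
      by (simp add: sum.Sigma copies finG 1 2)
  qed
  also have "\<dots> = (\<Sum>V\<in>Pow ?A. \<Sum>L\<in>Pow ?B. \<Sum>H\<in>labelled_copies F V L. ?h (card V) (card L) (?P H))"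
  proof (intro sum.cong refl)
    fix V L H assume "V \<in> Pow ?A" "L \<in> Pow ?B" "H \<in> labelled_copies F V L"
    then show "(\<Sum>G | nm_multigraph n m G \<and> edges H \<subseteq> edges G. weight \<delta> G) = ?h (card V) (card L) (?P H)"
      using sum_weight_extensions[of H n m \<delta>] card_edge_labels[of H]
      by (auto simp: labelled_copies_def)
  qed
  also have "\<dots> = (\<Sum>V\<in>Pow ?A. \<Sum>L\<in>Pow ?B. ?\<Phi> (card V) (card L))"
  proof (rule sum.cong[OF refl], rule sum.cong[OF refl])
    fix V L assume "V \<in> Pow ?A" "L \<in> Pow ?B"
    then have "finite V" "finite L"
      by (auto intro: finite_subset)
    \<comment> \<open>Here \<open>c d\<close> is the derivative of order \<open>d\<close>, while
      \<open>h\<close> multiplies by the factor of the vertices outside \<open>H\<close> and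
      extracts the coefficient.\<close>
    then show "(\<Sum>H\<in>labelled_copies F V L. ?h (card V) (card L) (?P H)) = ?\<Phi> (card V) (card L)"
      using sum_labelled_copies[OF F, where h = "?h (card V) (card L)" and c = "\<lambda>d. (fps_deriv ^^ d) (Delta \<delta>)"]
      by blast
  qed
  also have "\<dots> = (\<Sum>k\<le>n. of_nat (n choose k) * (\<Sum>l\<le>m. of_nat (m choose l) * ?\<Phi> k l))"
    by (simp add: sum_Pow_card[of ?B "?\<Phi> _"]
        sum_Pow_card[of ?A "\<lambda>k. \<Sum>l\<le>m. of_nat (m choose l) * ?\<Phi> k l"])
  finally show ?thesis .
qed

section \<open>Coefficient extraction on the generating function side\<close>

lemma coeff_zw_mult_exp_z:
  "coeff_zw n m (A * exp_z f) =
    (\<Sum>k\<le>n. coeff_zw k m A * (fps_const (1 / fact (n - k)) * f ^ (n - k)))"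
  \<comment> \<open>\<open>exp_z f\<close> is constant in \<open>w\<close>, so the product convolves
    in \<open>z\<close> only.\<close>
  unfolding coeff_zw_def exp_z_def fps_mult_right_const_nth
  by (simp add: fps_mult_nth atLeast0AtMost)

lemma coeff_zw_map_coeffs [simp]: "coeff_zw n m (map_coeffs h A) = h (coeff_zw n m A)"
  by (simp add: map_coeffs_def coeff_zw_def)

lemma y_subst_coeff_family_gf:
  assumes "multigraph_family F"
  shows "y_subst g (coeff_zw k l (family_gf F)) = fps_const (1 / (2 ^ l * fact l) * (1 / fact k)) *
    (\<Sum>H | H \<in> F \<and> card (verts H) = k \<and> card (edges H) = l. \<Prod>v\<in>verts H. g (deg H v))"
proof -
  have "finite (verts H)" if "H \<in> F" for H
    using assms that by (auto simp: multigraph_family_def nm_multigraph_def)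
  then show ?thesis
    by (simp add: coeff_zw_def family_gf_def y_subst_sum y_subst_prod_y_var sum_distrib_left)
qed

lemma coeff_zw_real_const_mult [simp]:
  "coeff_zw n m (real_const c * A) = c * coeff_zw n m A"
  "coeff_zw n m (A * real_const c) = coeff_zw n m A * c"
  by (simp_all add: coeff_zw_def real_const_def)

text \<open>The index is reversed to \<open>l = m - j\<close>: in the application \<open>l\<close>
  counts the edges of \<open>H\<close> and \<open>j\<close> those added to it.\<close>

lemma coeff_zw_suminf:
  fixes B :: "nat \<Rightarrow> real fps fps"
  shows "coeff_zw n m (suminf (\<lambda>j. B j * fps_X ^ j)) = (\<Sum>l\<le>m. coeff_zw n l (B (m - l)))"
proof -
  have "coeff_zw n m (suminf (\<lambda>j. B j * fps_X ^ j)) = (\<Sum>j\<le>m. coeff_zw n (m - j) (B j))"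
    by (simp add: coeff_zw_def fps_nth_suminf_fps_X_power fps_sum_nth)
  also have "\<dots> = (\<Sum>l\<le>m. coeff_zw n l (B (m - l)))"
    by (rule sum.reindex_bij_witness[of _ "\<lambda>l. m - l" "\<lambda>l. m - l"]) auto
  finally show ?thesis .
qed

theorem theorem6p3:
  fixes \<delta> :: "nat \<Rightarrow> real" and F :: "multigraph set" and n m :: nat
  assumes "\<And>d. 0 \<le> \<delta> d"
    and "multigraph_family F"
  shows "MG_marked F n m \<delta> =
    fact n * 2 ^ m * fact m *
    coeff_zw n m
      (suminf (\<lambda>j. real_const (fact (2 * j)) *
            coeff_x (2 * j)
              (map_coeffs (y_subst (\<lambda>d. (fps_deriv ^^ d) (Delta \<delta>))) (family_gf F)
                * exp_z (Delta \<delta>)) *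
            real_const (1 / (2 ^ j * fact j)) * fps_X ^ j))"
proof -
  let ?P = "\<lambda>H. \<Prod>v\<in>verts H. (fps_deriv ^^ deg H v) (Delta \<delta>)"
  let ?F = "\<lambda>k l. {H. H \<in> F \<and> card (verts H) = k \<and> card (edges H) = l}"
  let ?\<Phi> = "\<lambda>k l. \<Sum>H\<in>?F k l.
    fact (2 * (m - l)) * fps_nth (?P H * Delta \<delta> ^ (n - k)) (2 * (m - l))"
  let ?M = "map_coeffs (y_subst (\<lambda>d. (fps_deriv ^^ d) (Delta \<delta>))) (family_gf F) * exp_z (Delta \<delta>)"
  \<comment> \<open>\<open>2 ^ l\<close>, \<open>fact l\<close> and \<open>fact k\<close> come from
    the family, \<open>fact (n - k)\<close> from the exponential.\<close>
  have coeff: "fact (2 * (m - l)) * fps_nth (coeff_zw n l ?M) (2 * (m - l)) =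
      (\<Sum>k\<le>n. 1 / (2 ^ l * fact l * fact k * fact (n - k)) * ?\<Phi> k l)" for l
  proof -
    have eq: "coeff_zw n l ?M = (\<Sum>k\<le>n. fps_const (1 / (2 ^ l * fact l * fact k * fact (n - k))) *
        (\<Sum>H\<in>?F k l. ?P H * Delta \<delta> ^ (n - k)))"
    proof -
      have "fps_const (1 / (2 ^ l * fact l * fact k * fact (n - k))) =
          fps_const (1 / (2 ^ l * fact l) * (1 / fact k)) * fps_const (1 / fact (n - k) :: real)" for k
        by simp
      then show ?thesis
        unfolding coeff_zw_mult_exp_z coeff_zw_map_coeffs y_subst_coeff_family_gf[OF assms(2)]
        by (simp only: mult_ac sum_distrib_left)
    qed
    show ?thesis
      unfolding eq by (simp add: fps_sum_nth sum_distrib_left del: fact_Suc)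
  qed
  \<comment> \<open>\<open>2 ^ m\<close> splits into \<open>2 ^ l\<close> from the family and
    \<open>2 ^ (m - l)\<close> from the factor at \<open>w^j\<close> with \<open>j = m - l\<close>;
    the factorials form the binomial coefficients.\<close>
  have binom: "real (n choose k) * (real (m choose l) * x) =
      fact n * 2 ^ m * fact m * (1 / (2 ^ l * fact l * fact k * fact (n - k)) * x *
        (1 / (2 ^ (m - l) * fact (m - l))))"
    if "k \<le> n" "l \<le> m" for k l x
  proof -
    have "(2::real) ^ m = 2 ^ l * 2 ^ (m - l)"
      using that by (simp flip: power_add)
    then show ?thesis
      using that by (simp add: binomial_fact)
  qed
  have "MG_marked F n m \<delta> =
      (\<Sum>k\<le>n. \<Sum>l\<le>m. real (n choose k) * (real (m choose l) * ?\<Phi> k l))"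
    unfolding MG_marked_eq[OF assms(2)] by (simp only: sum_distrib_left)
  also have "\<dots> = (\<Sum>k\<le>n. \<Sum>l\<le>m. fact n * 2 ^ m * fact m *
      (1 / (2 ^ l * fact l * fact k * fact (n - k)) * ?\<Phi> k l * (1 / (2 ^ (m - l) * fact (m - l)))))"
    by (intro sum.cong refl binom) auto
  \<comment> \<open>Swapping makes \<open>l\<close> the outer index, matching the sum over
    \<open>j = m - l\<close>; the inner sum over \<open>k\<close> then becomes the coefficient of
    \<open>z^n\<close>.\<close>
  also have "\<dots> = fact n * 2 ^ m * fact m * (\<Sum>l\<le>m.
      (\<Sum>k\<le>n. 1 / (2 ^ l * fact l * fact k * fact (n - k)) * ?\<Phi> k l) * (1 / (2 ^ (m - l) * fact (m - l))))"
    unfolding sum_distrib_left sum_distrib_right by (rule sum.swap)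
  also have "\<dots> = fact n * 2 ^ m * fact m * (\<Sum>l\<le>m.
      fact (2 * (m - l)) * fps_nth (coeff_zw n l ?M) (2 * (m - l)) * (1 / (2 ^ (m - l) * fact (m - l))))"
    by (simp only: coeff)
  finally show ?thesis
    by (simp only: coeff_zw_suminf coeff_zw_real_const_mult coeff_x_def coeff_zw_map_coeffs)
qed

end
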